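(* Let $G$ be a finite abelian group, let $\Lambda$ be a subgroup of $G\times\widehat{G}$, and let $\tau\in\mathbb{C}^{o(G)}$, $f\in(\mathbb{C}^{o(G)})^*$. Then $$x=\sum_{\lambda\in\Lambda}f(\pi(\lambda)^{-1}x)\,\pi(\lambda)\tau,\quad\forall x\in\mathbb{C}^{o(G)}$$ if and only if $$f(\pi(\mu)^{-1}\tau)=\frac{o(G)}{o(\Lambda)}\,\delta_{\mu,0},\quad\forall\mu\in\Lambda^0,$$ where $\delta_{\mu,0}=1$ if $\mu=0$ is the identity element of $G\times\widehat{G}$ and $\delta_{\mu,0}=0$ otherwise.
   Context: $G$ is a finite abelian group (written additively), $\widehat{G}$ is its group of characters, and $o(\cdot)$ denotes the order of a group; $G\times\widehat{G}$ is written additively with identity $0$. $\mathbb{C}^{o(G)}$ is the space of vectors $(x_g)_{g\in G}$ and $(\mathbb{C}^{o(G)})^*$ is the space of linear functionals on it. For $\lambda=(k,\xi)\in G\times\widehat{G}$ the time-frequency shift operator $\pi(\lambda):\mathbb{C}^{o(G)}\to\mathbb{C}^{o(G)}$ is $\pi(\lambda)(x_g)_{g\in G}=(\xi(g)x_{g-k})_{g\in G}$; it is invertible. The adjoint subgroup of $\Lambda$ is $\Lambda^0=\{\mu\in G\times\widehat{G}:\pi(\lambda)\pi(\mu)=\pi(\mu)\pi(\lambda)\ \forall\lambda\in\Lambda\}$, which is a subgroup of $G\times\widehat{G}$. *)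

theory Defs
  imports "HOL-Analysis.Analysis"
begin

text \<open>A finite abelian group is a type of class \<open>{finite, ab_group_add}\<close>. Its dual group
  is a type as well, with pointwise multiplication written additively, so that
  \<open>'g \<times> 'g character\<close> inherits its additive group structure from the product instance.\<close>

typedef (overloaded) 'g character =
  "{\<xi> :: 'g::ab_group_add \<Rightarrow> complex. (\<forall>g h. \<xi> (g + h) = \<xi> g * \<xi> h) \<and> (\<forall>g. norm (\<xi> g) = 1)}"
  morphisms char_eval Abs_character
  by (rule exI[of _ "\<lambda>_. 1"]) simp

setup_lifting type_definition_character

instantiation character :: (ab_group_add) ab_group_add
begin

lift_definition zero_character :: "'a character" is "\<lambda>_. 1" by simp

lift_definition plus_character :: "'a character \<Rightarrow> 'a character \<Rightarrow> 'a character"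
  is "\<lambda>\<xi> \<eta> g. \<xi> g * \<eta> g" by (simp add: norm_mult)

lift_definition uminus_character :: "'a character \<Rightarrow> 'a character"
  is "\<lambda>\<xi> g. inverse (\<xi> g)" by (simp add: norm_inverse)

lift_definition minus_character :: "'a character \<Rightarrow> 'a character \<Rightarrow> 'a character"
  is "\<lambda>\<xi> \<eta> g. \<xi> g / \<eta> g" by (simp add: norm_divide)

instance
proof
  fix a b c :: "'a character"
  show "a + b + c = a + (b + c)" by transfer (simp add: mult.assoc)
  show "a + b = b + a" by transfer (simp add: mult.commute)
  show "0 + a = a" by transfer simp
  show "- a + a = 0"
  proof transfer
    fix \<xi> :: "'a \<Rightarrow> complex"
    assume "(\<forall>g h. \<xi> (g + h) = \<xi> g * \<xi> h) \<and> (\<forall>g. norm (\<xi> g) = 1)"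
    then have "\<xi> g \<noteq> 0" for g by (metis norm_zero zero_neq_one)
    then show "(\<lambda>g. inverse (\<xi> g) * \<xi> g) = (\<lambda>_. 1)" by simp
  qed
  show "a - b = a + - b" by transfer (simp add: divide_inverse)
qed

end

lemma char_eval_add: "char_eval \<xi> (g + h) = char_eval \<xi> g * char_eval \<xi> h"
  by transfer simp

lemma char_eval_nonzero [simp]: "char_eval \<xi> g \<noteq> 0"
  by transfer (metis norm_zero zero_neq_one)

lemma char_eval_0 [simp]: "char_eval \<xi> 0 = 1"
  using char_eval_add[of \<xi> 0 0] by simp

text \<open>The dual of a finite group is finite, so sums and cardinalities over sets of
  time-frequency shifts are the genuine ones.\<close>

instance character :: ("{finite, ab_group_add}") finite
proof
  define m :: "nat \<Rightarrow> 'a \<Rightarrow> 'a" where "m = (\<lambda>n g. ((+) g ^^ n) 0)"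
  have ev: "char_eval \<xi> (m n g) = char_eval \<xi> g ^ n" for \<xi> :: "'a character" and n g
    by (induction n) (simp_all add: m_def char_eval_add)
  define K where "K = (\<Union>g. \<Union>(i, j)\<in>{(i, j). i < j \<and> j \<le> CARD('a)}. {z::complex. z ^ (j - i) = 1})"
  have "finite {(i, j). i < j \<and> j \<le> CARD('a)}"
    by (rule finite_subset[of _ "{..CARD('a)} \<times> {..CARD('a)}"]) auto
  then have finK: "finite K"
    unfolding K_def by (auto intro!: finite_roots_unity)
  have inK: "char_eval \<xi> g \<in> K" for \<xi> :: "'a character" and g
  proof -
    have "\<not> inj_on (\<lambda>n. m n g) {..CARD('a)}"
    proof
      assume "inj_on (\<lambda>n. m n g) {..CARD('a)}"
      then have "card {..CARD('a)} \<le> CARD('a)"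
        by (rule card_inj_on_le) auto
      then show False by simp
    qed
    then obtain i j where "i \<le> CARD('a)" "j \<le> CARD('a)" "i \<noteq> j" "m i g = m j g"
      by (auto simp: inj_on_def)
    then obtain i j where ij: "i < j" "j \<le> CARD('a)" "m i g = m j g"
      by (metis linorder_neq_iff)
    then have "char_eval \<xi> g ^ i = char_eval \<xi> g ^ j" by (metis ev)
    also have "\<dots> = char_eval \<xi> g ^ (j - i) * char_eval \<xi> g ^ i"
      using ij by (simp flip: power_add)
    finally have "char_eval \<xi> g ^ (j - i) = 1" by simp
    then show ?thesis using ij unfolding K_def by blast
  qed
  have "finite (PiE (UNIV :: 'a set) (\<lambda>_. K))"
    using finK by (intro finite_PiE) auto
  moreover have "range (char_eval :: 'a character \<Rightarrow> _) \<subseteq> PiE UNIV (\<lambda>_. K)"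
    using inK by auto
  ultimately have "finite (range (char_eval :: 'a character \<Rightarrow> _))"
    by (rule finite_subset[rotated])
  then show "finite (UNIV :: 'a character set)"
    by (rule finite_imageD) (simp add: inj_def char_eval_inject)
qed

definition is_subgroup :: "'b::group_add set \<Rightarrow> bool" where
  "is_subgroup H \<longleftrightarrow> 0 \<in> H \<and> (\<forall>a\<in>H. \<forall>b\<in>H. a + b \<in> H) \<and> (\<forall>a\<in>H. - a \<in> H)"

definition tf_shift ::
  "'g::{finite, ab_group_add} \<times> 'g character \<Rightarrow> (complex, 'g) vec \<Rightarrow> (complex, 'g) vec" where
  "tf_shift = (\<lambda>(k, \<xi>) x. \<chi> g. char_eval \<xi> g * x $ (g - k))"

lemma bij_tf_shift: "bij (tf_shift \<nu>)"
proof (cases \<nu>)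
  case (Pair k \<xi>)
  define h where "h = (\<lambda>x::(complex, 'a) vec. \<chi> g. x $ (g + k) / char_eval \<xi> (g + k))"
  have "h \<circ> tf_shift \<nu> = id" "tf_shift \<nu> \<circ> h = id"
    by (auto simp: fun_eq_iff h_def tf_shift_def Pair vec_eq_iff)
  then show ?thesis by (rule o_bij)
qed

definition adjoint_subgroup ::
  "('g::{finite, ab_group_add} \<times> 'g character) set \<Rightarrow> ('g \<times> 'g character) set" where
  "adjoint_subgroup \<Lambda> =
     {\<mu>. \<forall>\<nu>\<in>\<Lambda>. tf_shift \<nu> \<circ> tf_shift \<mu> = tf_shift \<mu> \<circ> tf_shift \<nu>}"

end

theory Submission
  imports Defs
begin

text \<open>Write \<open>N\<close> for the order of the group, \<open>\<pi>\<close> for \<open>tf_shift\<close>, and \<open>S\<close> for the operator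
  \<open>x \<mapsto> \<Sum>\<nu>\<in>\<Lambda>. f (\<pi>(\<nu>)\<^sup>-\<^sup>1 x) \<pi>(\<nu>) \<tau>\<close>. The \<open>N\<^sup>2\<close> operators \<open>\<pi>(\<mu>)\<close> form a basis of the linear operators on
  \<open>\<complex>\<^sup>N\<close>, orthogonal for the trace form. In this basis the rank-one operator \<open>x \<mapsto> f(x) \<tau>\<close> has the
  coefficients \<open>f (\<pi>(\<mu>)\<^sup>-\<^sup>1 \<tau>) / N\<close> (\<open>rank_one_expansion\<close>).

  The operator \<open>S\<close> is the sum of the conjugates of this rank-one operator by the \<open>\<pi>(\<nu>)\<close> with
  \<open>\<nu> \<in> \<Lambda>\<close>. Conjugation by \<open>\<pi>(\<nu>)\<close> multiplies \<open>\<pi>(\<mu>)\<close> by a phase which, as a function of \<open>\<nu>\<close>, is a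
  character of \<open>\<Lambda>\<close>, and which is trivial exactly when \<open>\<mu> \<in> \<Lambda>\<^sup>0\<close>. Summing over \<open>\<Lambda>\<close> therefore
  multiplies the coefficient at \<open>\<mu>\<close> by \<open>o(\<Lambda>)\<close> if \<open>\<mu> \<in> \<Lambda>\<^sup>0\<close> and annihilates it otherwise:
  \<open>S = (o(\<Lambda>) / N) \<Sum>\<mu>\<in>\<Lambda>\<^sup>0. f (\<pi>(\<mu>)\<^sup>-\<^sup>1 \<tau>) \<pi>(\<mu>)\<close> (\<open>janssen_representation\<close>).
  Since \<open>\<pi>(0)\<close> is the identity, comparing coefficients in \<open>S = \<pi>(0)\<close> gives the theorem; this is
  legitimate by \<open>tf_shift_independent\<close>.

  Both the expansion and the independence rest on the orthogonality relations for characters, and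
  the relation that sums over the dual group needs enough characters to separate points
  (\<open>character_separates\<close>).\<close>

section \<open>Characters separate points\<close>

text \<open>A function is decomposed into eigenfunctions of the translation by \<open>a\<close> by a discrete Fourier
  transform along the orbits of this translation. Every component is a linear combination of
  translates of \<open>v\<close>, which is why it keeps the eigenvalues that \<open>v\<close> has for other translations.\<close>

lemma translation_eigen_decomposition:
  fixes v :: "'g::{finite, ab_group_add} \<Rightarrow> complex" and a :: 'g
  obtains w :: "nat \<Rightarrow> 'g \<Rightarrow> complex" and n :: nat
  where "\<And>x. v x = (\<Sum>j<n. w j x)"
    and "\<And>j. \<exists>z. \<forall>x. w j (x + a) = z * w j x"
    and "\<And>j b z. \<forall>x. v (x + b) = z * v x \<Longrightarrow> \<forall>x. w j (x + b) = z * w j x"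
proof -
  define m where "m = (\<lambda>k. ((+) a ^^ k) 0)"
  have m_Suc: "m (Suc k) = a + m k" and m_0: "m 0 = 0" for k
    by (simp_all add: m_def)
  have "\<exists>n>0. ((+) a ^^ n) 0 = 0"
    by (rule funpow_inj_finite[of "(+) a" 0]) auto
  then obtain n where n: "n > 0" "m n = 0"
    by (auto simp: m_def)
  define \<omega> where "\<omega> = cis (2 * pi / real n)"
  have \<omega>_pow: "\<omega> ^ k = cis (2 * pi * real k / real n)" for k
  proof -
    have "2 * pi * real k / real n = real k * (2 * pi / real n)" by simp
    then show ?thesis by (simp only: \<omega>_def Complex.DeMoivre)
  qed
  have \<omega>_n: "\<omega> ^ n = 1"
    using n by (simp add: \<omega>_pow)
  have \<omega>_nontrivial: "\<omega> ^ k \<noteq> 1" if "0 < k" "k < n" for k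
    using that complex_root_unity_eq_1[of n k] \<omega>_pow[of k] n
    by (auto simp: cis_conv_exp mult_ac dest: nat_dvd_not_less)
  define w where "w = (\<lambda>j x. (\<Sum>k<n. (\<omega> ^ j) ^ k * v (x + m k)) / of_nat n)"
  show thesis
  proof (rule that[of w n])
    fix x
    have root_sum: "(\<Sum>j<n. (\<omega> ^ j) ^ k) = (if k = 0 then of_nat n else 0)" if "k < n" for k
    proof -
      have "(\<Sum>j<n. (\<omega> ^ j) ^ k) = (\<Sum>j<n. (\<omega> ^ k) ^ j)"
        by (simp add: mult.commute flip: power_mult)
      moreover have "(\<Sum>j<n. (\<omega> ^ k) ^ j) = 0" if "k \<noteq> 0"
      proof -
        have "(\<omega> ^ k) ^ n = 1"
          by (metis \<omega>_n mult.commute power_mult power_one)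
        then show ?thesis
          using \<omega>_nontrivial[of k] that \<open>k < n\<close> by (simp add: geometric_sum)
      qed
      ultimately show ?thesis by simp
    qed
    have "(\<Sum>j<n. w j x) = (\<Sum>k<n. \<Sum>j<n. (\<omega> ^ j) ^ k * v (x + m k)) / of_nat n"
      unfolding w_def sum_divide_distrib[symmetric] by (subst sum.swap) simp
    also have "\<dots> = (\<Sum>k<n. (if k = 0 then of_nat n else 0) * v (x + m k)) / of_nat n"
      by (intro arg_cong2[of _ _ _ _ "(/)"] sum.cong refl)
        (simp add: root_sum flip: sum_distrib_right)
    also have "(\<Sum>k<n. (if k = 0 then of_nat n else 0) * v (x + m k))
        = (\<Sum>k<n. if k = 0 then of_nat n * v x else 0)"
      by (rule sum.cong) (auto simp: m_0)
    also have "\<dots> = of_nat n * v x"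
      using n by simp
    finally show "v x = (\<Sum>j<n. w j x)"
      using n by simp
  next
    fix j
    define z where "z = \<omega> ^ j"
    have z_n: "z ^ n = 1"
      unfolding z_def by (metis \<omega>_n mult.commute power_mult power_one)
    have "w j x = z * w j (x + a)" for x
    proof -
      let ?t = "\<lambda>k. z ^ k * v (x + m k)"
      \<comment> \<open>Both ends of the sum agree, because \<open>m\<close> and the powers of \<open>z\<close> have period \<open>n\<close>.\<close>
      have "?t 0 + (\<Sum>k<n. ?t (Suc k)) = (\<Sum>k<n. ?t k) + ?t n"
        by (rule trans[OF sum.lessThan_Suc_shift[symmetric] sum.lessThan_Suc])
      then have "(\<Sum>k<n. ?t k) = (\<Sum>k<n. ?t (Suc k))"
        using n z_n by (simp add: m_0)
      also have "\<dots> = z * (\<Sum>k<n. z ^ k * v (x + a + m k))"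
        by (simp add: sum_distrib_left m_Suc add.assoc mult.assoc)
      finally show ?thesis
        by (simp add: w_def z_def)
    qed
    moreover have "z \<noteq> 0"
      using z_n n by (metis power_0_left less_irrefl zero_neq_one)
    ultimately have "\<forall>x. w j (x + a) = inverse z * w j x"
      by (metis mult.assoc left_inverse mult_1)
    then show "\<exists>z. \<forall>x. w j (x + a) = z * w j x" by blast
  next
    fix j b z
    assume v: "\<forall>x. v (x + b) = z * v x"
    have "v (x + b + m k) = z * v (x + m k)" for x k
      using v by (metis add.assoc add.commute)
    then show "\<forall>x. w j (x + b) = z * w j x"
      by (simp add: w_def sum_distrib_left mult.left_commute)
  qed
qed

text \<open>The property of not being invariant under \<open>g\<close> passes to some summand of every finite sum, so
  it survives when the translations are diagonalised one after the other.\<close>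

lemma ex_noninvariant_eigenfunction:
  fixes g :: "'g::{finite, ab_group_add}"
  assumes "g \<noteq> 0"
  shows "\<exists>v. (\<forall>a. \<exists>z::complex. \<forall>x. v (x + a) = z * v x) \<and> (\<exists>x. v (x + g) \<noteq> v x)"
proof -
  have "\<exists>v. (\<forall>a\<in>A. \<exists>z::complex. \<forall>x. v (x + a) = z * v x) \<and> (\<exists>x. v (x + g) \<noteq> v x)"
    if "finite A" for A :: "'g set"
    using that
  proof (induction A)
    case empty
    have "(if 0 + g = 0 then 1 else 0) \<noteq> (if (0::'g) = 0 then 1 else 0 :: complex)"
      using assms by simp
    then show ?case
      by (intro exI[of _ "\<lambda>x. if x = 0 then 1 else 0"]) blast
  next
    case (insert a A)
    then obtain v x where v: "\<forall>a\<in>A. \<exists>z::complex. \<forall>x. v (x + a) = z * v x" "v (x + g) \<noteq> v x"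
      by blast
    obtain w and n :: nat where w: "\<And>x. v x = (\<Sum>j<n. w j x)"
        "\<And>j. \<exists>z. \<forall>x. w j (x + a) = z * w j x"
        "\<And>j b z. \<forall>x. v (x + b) = z * v x \<Longrightarrow> \<forall>x. w j (x + b) = z * w j x"
      using translation_eigen_decomposition[of v a] by blast
    have "\<exists>j. w j (x + g) \<noteq> w j x"
    proof (rule ccontr)
      assume "\<nexists>j. w j (x + g) \<noteq> w j x"
      then have "v (x + g) = v x"
        by (simp add: w(1))
      with v(2) show False ..
    qed
    then obtain j where "w j (x + g) \<noteq> w j x" ..
    moreover have "\<exists>z. \<forall>x. w j (x + b) = z * w j x" if "b \<in> insert a A" for b
    proof (cases "b = a")
      case True
      with w(2) show ?thesis by simp
    next
      case False
      with that v(1) obtain z where "\<forall>x. v (x + b) = z * v x" by blast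
      then show ?thesis using w(3) by blast
    qed
    ultimately show ?case by blast
  qed
  from this[of UNIV] show ?thesis by simp
qed

text \<open>The eigenvalues of a common eigenfunction of all translations form a character. They have
  modulus one since the modulus of the eigenfunction attains its maximum.\<close>

lemma character_separates:
  fixes g :: "'g::{finite, ab_group_add}"
  assumes "g \<noteq> 0"
  obtains \<xi> :: "'g character" where "char_eval \<xi> g \<noteq> 1"
proof -
  obtain v x\<^sub>1 where v: "\<forall>a. \<exists>z::complex. \<forall>x. v (x + a) = z * v x" "v (x\<^sub>1 + g) \<noteq> v x\<^sub>1"
    using ex_noninvariant_eigenfunction[OF assms] by blast
  then obtain \<phi> where \<phi>: "\<And>a x. v (x + a) = \<phi> a * v x"
    by metis
  have "finite (range (\<lambda>x. norm (v x)))" by simp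
  then obtain x\<^sub>0 where x\<^sub>0: "\<And>x. norm (v x) \<le> norm (v x\<^sub>0)"
    by (metis (mono_tags, lifting) Max_ge Max_in empty_is_image imageE rangeI UNIV_not_empty)
  have nz: "v x\<^sub>0 \<noteq> 0"
    using x\<^sub>0 v(2) by (metis norm_le_zero_iff norm_zero)
  have mult: "\<phi> (a + b) = \<phi> a * \<phi> b" for a b
    using \<phi>[of x\<^sub>0 "a + b"] \<phi>[of "x\<^sub>0 + a" b] \<phi>[of x\<^sub>0 a] nz by (simp add: add.assoc)
  have "\<phi> 0 = 1"
    using \<phi>[of x\<^sub>0 0] nz by simp
  have le: "norm (\<phi> a) \<le> 1" for a
    using x\<^sub>0[of "x\<^sub>0 + a"] nz by (simp add: \<phi> norm_mult)
  have "norm (\<phi> a) = 1" for a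
  proof -
    have "norm (\<phi> a) * norm (\<phi> (- a)) = 1"
      using mult[of a "- a"] \<open>\<phi> 0 = 1\<close> by (simp flip: norm_mult)
    then show ?thesis
      using le[of a] le[of "- a"] by (metis mult_left_le norm_ge_zero order_antisym)
  qed
  then have "char_eval (Abs_character \<phi>) = \<phi>"
    by (intro Abs_character_inverse) (simp add: mult)
  moreover have "\<phi> g \<noteq> 1"
    using v(2) \<phi>[of x\<^sub>1 g] by auto
  ultimately show thesis
    by (metis that)
qed

section \<open>Orthogonality relations\<close>

lemma sum_multiplicative_subgroup:
  fixes H :: "'b::group_add set" and \<phi> :: "'b \<Rightarrow> complex"
  assumes H: "is_subgroup H" and mult: "\<And>a b. a \<in> H \<Longrightarrow> b \<in> H \<Longrightarrow> \<phi> (a + b) = \<phi> a * \<phi> b"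
  shows "(\<Sum>a\<in>H. \<phi> a) = (if \<forall>a\<in>H. \<phi> a = 1 then of_nat (card H) else 0)"
proof (cases "\<forall>a\<in>H. \<phi> a = 1")
  case False
  then obtain b where b: "b \<in> H" "\<phi> b \<noteq> 1" by blast
  have "(\<Sum>a\<in>H. \<phi> (b + a)) = (\<Sum>a\<in>H. \<phi> a)"
  proof (rule sum.reindex_bij_witness[of _ "\<lambda>a. - b + a" "\<lambda>a. b + a"])
    show "- b + a \<in> H" if "a \<in> H" for a
      using H b that unfolding is_subgroup_def by blast
    show "b + a \<in> H" if "a \<in> H" for a
      using H b that unfolding is_subgroup_def by blast
  qed (simp_all add: add.assoc[symmetric])
  then have "\<phi> b * (\<Sum>a\<in>H. \<phi> a) = (\<Sum>a\<in>H. \<phi> a)"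
    using b by (simp add: mult sum_distrib_left)
  with b show ?thesis by auto
qed simp

lemma is_subgroup_UNIV: "is_subgroup UNIV"
  by (simp add: is_subgroup_def)

lemma char_eval_plus: "char_eval (\<xi> + \<eta>) g = char_eval \<xi> g * char_eval \<eta> g"
  by transfer simp

lemma char_eval_zero: "char_eval 0 g = 1"
  by transfer simp

lemma char_eval_minus: "char_eval (\<xi> - \<eta>) g = char_eval \<xi> g / char_eval \<eta> g"
  by transfer simp

lemma char_eval_diff: "char_eval \<xi> (g - h) = char_eval \<xi> g / char_eval \<xi> h"
  using char_eval_add[of \<xi> "g - h" h] by (simp add: field_simps)

lemma char_eval_eq_1_iff: "(\<forall>g. char_eval \<xi> g = 1) \<longleftrightarrow> \<xi> = 0"
  by (metis char_eval_inject char_eval_zero ext)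

lemma sum_char_over_group:
  fixes \<xi> :: "'g::{finite, ab_group_add} character"
  shows "(\<Sum>g\<in>UNIV. char_eval \<xi> g) = (if \<xi> = 0 then of_nat CARD('g) else 0)"
  using sum_multiplicative_subgroup[of UNIV "char_eval \<xi>"]
  by (simp add: is_subgroup_UNIV char_eval_add char_eval_eq_1_iff)

lemma sum_char_over_dual_card:
  fixes g :: "'g::{finite, ab_group_add}"
  shows "(\<Sum>\<xi>\<in>UNIV. char_eval \<xi> g) = (if g = 0 then of_nat CARD('g character) else 0)"
  using sum_multiplicative_subgroup[of UNIV "\<lambda>\<xi>. char_eval \<xi> g"] character_separates[of g]
  by (auto simp: is_subgroup_UNIV char_eval_plus)

text \<open>Sum all values of all characters, once by rows and once by columns.\<close>

lemma card_dual: "CARD('g::{finite, ab_group_add} character) = CARD('g)"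
proof -
  have "(\<Sum>g\<in>UNIV. \<Sum>\<xi>\<in>UNIV. char_eval \<xi> (g :: 'g)) = (\<Sum>\<xi>\<in>UNIV. \<Sum>g\<in>UNIV. char_eval \<xi> (g :: 'g))"
    by (rule sum.swap)
  then have "(of_nat CARD('g character) :: complex) = of_nat CARD('g)"
    by (simp add: sum_char_over_group sum_char_over_dual_card)
  then show ?thesis
    using of_nat_eq_iff by blast
qed

lemma sum_char_over_dual:
  fixes g :: "'g::{finite, ab_group_add}"
  shows "(\<Sum>\<xi>\<in>UNIV. char_eval \<xi> g) = (if g = 0 then of_nat CARD('g) else 0)"
  by (simp add: sum_char_over_dual_card card_dual)

section \<open>The algebra of time-frequency shifts\<close>

lemma tf_shift_nth: "tf_shift (k, \<xi>) x $ g = char_eval \<xi> g * x $ (g - k)"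
  by (simp add: tf_shift_def)

lemma inv_tf_shift_nth: "inv (tf_shift (k, \<xi>)) x $ g = x $ (g + k) / char_eval \<xi> (g + k)"
proof -
  have "tf_shift (k, \<xi>) (\<chi> g. x $ (g + k) / char_eval \<xi> (g + k)) = x"
    by (simp add: vec_eq_iff tf_shift_nth)
  then have "inv (tf_shift (k, \<xi>)) x = (\<chi> g. x $ (g + k) / char_eval \<xi> (g + k))"
    by (rule inv_f_eq[OF bij_is_inj[OF bij_tf_shift]])
  then show ?thesis by simp
qed

lemma tf_shift_inv: "tf_shift \<nu> (inv (tf_shift \<nu>) x) = x"
  by (simp add: bij_tf_shift bij_is_surj surj_f_inv_f)

lemma tf_shift_0: "tf_shift 0 x = x"
  by (simp add: vec_eq_iff tf_shift_nth zero_prod_def char_eval_zero)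

lemma tf_shift_scale: "tf_shift \<nu> (c *s x) = c *s tf_shift \<nu> x"
  by (cases \<nu>) (simp add: vec_eq_iff tf_shift_nth)

lemma tf_shift_sum: "tf_shift \<nu> (\<Sum>i\<in>I. x i) = (\<Sum>i\<in>I. tf_shift \<nu> (x i))"
  by (cases \<nu>) (simp add: vec_eq_iff tf_shift_nth sum_distrib_left)

text \<open>The commutation phase is the symplectic bicharacter of the time-frequency plane.\<close>

definition tf_phase :: "'g::{finite, ab_group_add} \<times> 'g character \<Rightarrow> 'g \<times> 'g character \<Rightarrow> complex"
  where "tf_phase = (\<lambda>(k, \<xi>) (m, \<eta>). char_eval \<xi> m / char_eval \<eta> k)"

lemma tf_shift_commute:
  "tf_shift \<nu> (tf_shift \<mu> x) = tf_phase \<nu> \<mu> *s tf_shift \<mu> (tf_shift \<nu> x)"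
  by (cases \<nu>; cases \<mu>)
    (simp add: vec_eq_iff tf_shift_nth tf_phase_def char_eval_diff diff_diff_eq add.commute)

lemma tf_shift_conjugate:
  "tf_shift \<nu> (tf_shift \<mu> (inv (tf_shift \<nu>) x)) = tf_phase \<nu> \<mu> *s tf_shift \<mu> x"
  by (simp add: tf_shift_commute[of \<nu>] tf_shift_inv)

lemma tf_phase_add: "tf_phase (\<nu> + \<nu>') \<mu> = tf_phase \<nu> \<mu> * tf_phase \<nu>' \<mu>"
  by (cases \<nu>; cases \<nu>'; cases \<mu>)
    (simp add: tf_phase_def char_eval_add char_eval_plus)

lemma adjoint_subgroup_iff_phase:
  "\<mu> \<in> adjoint_subgroup \<Lambda> \<longleftrightarrow> (\<forall>\<nu>\<in>\<Lambda>. tf_phase \<nu> \<mu> = 1)"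
proof -
  have "tf_shift \<nu> \<circ> tf_shift \<mu> = tf_shift \<mu> \<circ> tf_shift \<nu> \<longleftrightarrow> tf_phase \<nu> \<mu> = 1" for \<nu>
  proof
    assume comm: "tf_shift \<nu> \<circ> tf_shift \<mu> = tf_shift \<mu> \<circ> tf_shift \<nu>"
    \<comment> \<open>The phase is read off from any vector on which the common product takes a nonzero value;
      the constant vector serves.\<close>
    let ?y = "tf_shift \<mu> (tf_shift \<nu> (\<chi> g. 1))"
    have "?y = tf_phase \<nu> \<mu> *s ?y"
      using tf_shift_commute[of \<nu> \<mu>] comm by (metis comp_apply)
    then have "?y $ 0 = tf_phase \<nu> \<mu> * ?y $ 0"
      by (metis vector_smult_component)
    moreover have "?y $ 0 \<noteq> 0"
      by (cases \<nu>; cases \<mu>) (simp add: tf_shift_nth)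
    ultimately show "tf_phase \<nu> \<mu> = 1" by simp
  next
    assume "tf_phase \<nu> \<mu> = 1"
    then show "tf_shift \<nu> \<circ> tf_shift \<mu> = tf_shift \<mu> \<circ> tf_shift \<nu>"
      by (simp add: fun_eq_iff tf_shift_commute[of \<nu>])
  qed
  then show ?thesis
    by (simp add: adjoint_subgroup_def)
qed

lemma sum_tf_phase:
  assumes "is_subgroup \<Lambda>"
  shows "(\<Sum>\<nu>\<in>\<Lambda>. tf_phase \<nu> \<mu>) = (if \<mu> \<in> adjoint_subgroup \<Lambda> then of_nat (card \<Lambda>) else 0)"
  using sum_multiplicative_subgroup[of \<Lambda> "\<lambda>\<nu>. tf_phase \<nu> \<mu>"] assms
  by (simp add: tf_phase_add adjoint_subgroup_iff_phase)

section \<open>Time-frequency shifts as an operator basis\<close>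

text \<open>Applying the combination to unit vectors isolates one time shift \<open>k\<close> and leaves a vanishing
  combination of characters, from which Fourier inversion recovers the coefficients.\<close>

lemma tf_shift_independent:
  fixes c :: "'g::{finite, ab_group_add} \<times> 'g character \<Rightarrow> complex"
  assumes "\<And>x. (\<Sum>\<mu>\<in>UNIV. c \<mu> *s tf_shift \<mu> x) = 0"
  shows "c \<mu> = 0"
proof -
  obtain k \<eta> where \<mu>: "\<mu> = (k, \<eta>)" by (cases \<mu>)
  have chars: "(\<Sum>\<xi>\<in>UNIV. c (k, \<xi>) * char_eval \<xi> g) = 0" for g
  proof -
    let ?e = "(\<chi> h. if h = g - k then 1 else 0) :: (complex, 'g) vec"
    have "0 = (\<Sum>\<mu>\<in>UNIV. c \<mu> *s tf_shift \<mu> ?e) $ g"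
      by (simp add: assms)
    also have "\<dots> = (\<Sum>(l, \<xi>)\<in>UNIV \<times> UNIV. if l = k then c (l, \<xi>) * char_eval \<xi> g else 0)"
      unfolding sum_component UNIV_Times_UNIV
      by (rule sum.cong) (auto simp: tf_shift_nth)
    also have "\<dots> = (\<Sum>\<xi>\<in>UNIV. \<Sum>l\<in>UNIV. if l = k then c (l, \<xi>) * char_eval \<xi> g else 0)"
      unfolding sum.cartesian_product[symmetric] by (rule sum.swap)
    finally show ?thesis
      by simp
  qed
  have "0 = (\<Sum>g\<in>UNIV. (\<Sum>\<xi>\<in>UNIV. c (k, \<xi>) * char_eval \<xi> g) / char_eval \<eta> g)"
    by (simp add: chars)
  also have "\<dots> = (\<Sum>\<xi>\<in>UNIV. c (k, \<xi>) * (\<Sum>g\<in>UNIV. char_eval (\<xi> - \<eta>) g))"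
    unfolding sum_divide_distrib
    by (subst sum.swap) (simp add: sum_distrib_left char_eval_minus)
  also have "\<dots> = (\<Sum>\<xi>\<in>UNIV. if \<xi> = \<eta> then c (k, \<xi>) * of_nat CARD('g) else 0)"
    by (rule sum.cong) (simp_all add: sum_char_over_group)
  also have "\<dots> = c (k, \<eta>) * of_nat CARD('g)"
    by simp
  finally show ?thesis
    by (simp add: \<mu>)
qed

text \<open>The coefficient at \<open>\<mu>\<close> is the trace of \<open>\<pi>(\<mu>)\<^sup>-\<^sup>1\<close> composed with the rank-one operator
  \<open>x \<mapsto> f(x) \<tau>\<close>, as for any operator expanded in this orthogonal basis. In coordinates, the sum over
  the frequency shifts \<open>\<xi>\<close> forces the index \<open>h + k\<close> of \<open>\<tau>\<close> to equal \<open>g\<close>, and the remaining sum over the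
  time shifts \<open>k\<close> rebuilds \<open>f x\<close>.\<close>

lemma rank_one_expansion:
  fixes f :: "(complex, 'g::{finite, ab_group_add}) vec \<Rightarrow> complex"
  assumes "Vector_Spaces.linear (*s) (*) f"
  shows "of_nat CARD('g) *s (f x *s \<tau>) = (\<Sum>\<mu>\<in>UNIV. f (inv (tf_shift \<mu>) \<tau>) *s tf_shift \<mu> x)"
proof -
  interpret f: Vector_Spaces.linear "(*s)" "(*)" f by fact
  have f: "f y = (\<Sum>h\<in>UNIV. f (axis h 1) * y $ h)" for y
  proof -
    have "f y = f (\<Sum>h\<in>UNIV. y $ h *s axis h 1)"
      by (simp add: basis_expansion)
    then show ?thesis
      by (simp add: f.sum f.scale mult.commute)
  qed
  have "(\<Sum>\<mu>\<in>UNIV. f (inv (tf_shift \<mu>) \<tau>) *s tf_shift \<mu> x) $ g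
      = of_nat CARD('g) * (f x * \<tau> $ g)" for g
  proof -
    have "(\<Sum>\<mu>\<in>UNIV. f (inv (tf_shift \<mu>) \<tau>) *s tf_shift \<mu> x) $ g
        = (\<Sum>(k, \<xi>)\<in>UNIV \<times> UNIV. \<Sum>h\<in>UNIV.
            f (axis h 1) * \<tau> $ (h + k) * x $ (g - k) * char_eval \<xi> (g - (h + k)))"
      unfolding sum_component UNIV_Times_UNIV
      by (rule sum.cong)
        (auto simp: f[of "inv _ _"] inv_tf_shift_nth tf_shift_nth sum_distrib_left sum_distrib_right
          char_eval_diff[of _ g] mult_ac)
    also have "\<dots> = (\<Sum>k\<in>UNIV. \<Sum>h\<in>UNIV. \<Sum>\<xi>\<in>UNIV.
            f (axis h 1) * \<tau> $ (h + k) * x $ (g - k) * char_eval \<xi> (g - (h + k)))"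
      unfolding sum.cartesian_product[symmetric] by (intro sum.cong refl sum.swap)
    also have "\<dots> = (\<Sum>k\<in>UNIV. \<Sum>h\<in>UNIV. if h = g - k
            then f (axis h 1) * \<tau> $ (h + k) * x $ (g - k) * of_nat CARD('g) else 0)"
      unfolding sum_distrib_left[symmetric]
      by (intro sum.cong refl) (auto simp: sum_char_over_dual algebra_simps)
    also have "\<dots> = (\<Sum>k\<in>UNIV. f (axis (g - k) 1) * \<tau> $ g * x $ (g - k) * of_nat CARD('g))"
      by simp
    also have "\<dots> = (\<Sum>h\<in>UNIV. f (axis h 1) * \<tau> $ g * x $ h * of_nat CARD('g))"
      by (rule sum.reindex_bij_witness[of _ "\<lambda>h. g - h" "\<lambda>k. g - k"]) auto
    also have "\<dots> = of_nat CARD('g) * (f x * \<tau> $ g)"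
      by (simp add: f[of x] sum_distrib_left sum_distrib_right mult_ac)
    finally show ?thesis .
  qed
  then show ?thesis
    by (simp add: vec_eq_iff)
qed

section \<open>Janssen representation and duality\<close>

text \<open>Averaging the rank-one operator over conjugation by \<open>\<Lambda>\<close> projects it onto the operators that
  commute with \<open>\<Lambda>\<close>; in the basis of time-frequency shifts this keeps exactly the terms of the
  adjoint subgroup.\<close>

lemma janssen_representation:
  fixes \<Lambda> :: "('g::{finite, ab_group_add} \<times> 'g character) set"
  assumes \<Lambda>: "is_subgroup \<Lambda>" and f: "Vector_Spaces.linear (*s) (*) f"
  shows "of_nat CARD('g) *s (\<Sum>\<nu>\<in>\<Lambda>. f (inv (tf_shift \<nu>) x) *s tf_shift \<nu> \<tau>) =
    of_nat (card \<Lambda>) *s (\<Sum>\<mu>\<in>adjoint_subgroup \<Lambda>. f (inv (tf_shift \<mu>) \<tau>) *s tf_shift \<mu> x)"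
proof -
  let ?a = "\<lambda>\<mu>. f (inv (tf_shift \<mu>) \<tau>)"
  have "of_nat CARD('g) *s (\<Sum>\<nu>\<in>\<Lambda>. f (inv (tf_shift \<nu>) x) *s tf_shift \<nu> \<tau>)
      = (\<Sum>\<nu>\<in>\<Lambda>. tf_shift \<nu> (of_nat CARD('g) *s (f (inv (tf_shift \<nu>) x) *s \<tau>)))"
    by (simp add: vec.scale_sum_right tf_shift_scale)
  also have "\<dots> = (\<Sum>\<nu>\<in>\<Lambda>. \<Sum>\<mu>\<in>UNIV. (tf_phase \<nu> \<mu> * ?a \<mu>) *s tf_shift \<mu> x)"
    unfolding rank_one_expansion[OF f] tf_shift_sum tf_shift_scale tf_shift_conjugate
    by (simp add: mult.commute)
  also have "\<dots> = (\<Sum>\<mu>\<in>UNIV. ((\<Sum>\<nu>\<in>\<Lambda>. tf_phase \<nu> \<mu>) * ?a \<mu>) *s tf_shift \<mu> x)"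
    by (subst sum.swap) (simp add: sum_distrib_right vec.scale_sum_left)
  also have "\<dots> = (\<Sum>\<mu>\<in>UNIV. if \<mu> \<in> adjoint_subgroup \<Lambda>
      then of_nat (card \<Lambda>) *s (?a \<mu> *s tf_shift \<mu> x) else 0)"
    by (rule sum.cong) (simp_all add: sum_tf_phase[OF \<Lambda>])
  also have "\<dots> = (\<Sum>\<mu>\<in>adjoint_subgroup \<Lambda>. of_nat (card \<Lambda>) *s (?a \<mu> *s tf_shift \<mu> x))"
    by (simp add: sum.If_cases)
  finally show ?thesis
    by (simp add: vec.scale_sum_right)
qed

lemma zero_in_adjoint_subgroup: "0 \<in> adjoint_subgroup \<Lambda>"
  by (simp add: adjoint_subgroup_def fun_eq_iff tf_shift_0)

theorem theorem3p9:
  fixes \<Lambda> :: "('g::{finite, ab_group_add} \<times> 'g character) set"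
    and \<tau> :: "(complex, 'g) vec"
    and f :: "(complex, 'g) vec \<Rightarrow> complex"
  assumes "is_subgroup \<Lambda>"
    and "Vector_Spaces.linear (*s) (*) f"
  shows "(\<forall>x. x = (\<Sum>\<nu>\<in>\<Lambda>. f (inv (tf_shift \<nu>) x) *s tf_shift \<nu> \<tau>)) \<longleftrightarrow>
    (\<forall>\<mu>\<in>adjoint_subgroup \<Lambda>.
       f (inv (tf_shift \<mu>) \<tau>) =
         of_nat CARD('g) / of_nat (card \<Lambda>) * (if \<mu> = 0 then 1 else 0))"
    (is "(\<forall>x. x = ?S x) \<longleftrightarrow> (\<forall>\<mu>\<in>?\<Lambda>0. ?a \<mu> = ?N / ?L * ?\<delta> \<mu>)")
proof -
  have N: "?N \<noteq> (0::complex)" by simp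
  have "0 \<in> \<Lambda>"
    using assms(1) by (simp add: is_subgroup_def)
  then have L: "?L \<noteq> (0::complex)"
    using finite[of \<Lambda>] by auto
  have S: "?N *s ?S x = (\<Sum>\<mu>\<in>UNIV. (if \<mu> \<in> ?\<Lambda>0 then ?L * ?a \<mu> else 0) *s tf_shift \<mu> x)" for x
  proof -
    have "(\<Sum>\<mu>\<in>UNIV. (if \<mu> \<in> ?\<Lambda>0 then ?L * ?a \<mu> else 0) *s tf_shift \<mu> x)
        = (\<Sum>\<mu>\<in>UNIV. if \<mu> \<in> ?\<Lambda>0 then (?L * ?a \<mu>) *s tf_shift \<mu> x else 0)"
      by (rule sum.cong) simp_all
    also have "\<dots> = (\<Sum>\<mu>\<in>?\<Lambda>0. (?L * ?a \<mu>) *s tf_shift \<mu> x)"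
      by (simp add: sum.If_cases)
    finally show ?thesis
      unfolding janssen_representation[OF assms] by (simp add: vec.scale_sum_right)
  qed
  have I: "?N *s x = (\<Sum>\<mu>\<in>UNIV. (?N * ?\<delta> \<mu>) *s tf_shift \<mu> x)" for x :: "(complex, 'g) vec"
  proof -
    have "(\<Sum>\<mu>\<in>UNIV. (?N * ?\<delta> \<mu>) *s tf_shift \<mu> x)
        = (\<Sum>\<mu>\<in>UNIV. if \<mu> = 0 then ?N *s tf_shift \<mu> x else 0)"
      by (rule sum.cong) simp_all
    then show ?thesis
      by (simp add: tf_shift_0)
  qed
  let ?c = "\<lambda>\<mu>. (if \<mu> \<in> ?\<Lambda>0 then ?L * ?a \<mu> else 0) - ?N * ?\<delta> \<mu>"
  have diff: "?N *s ?S x - ?N *s x = (\<Sum>\<mu>\<in>UNIV. ?c \<mu> *s tf_shift \<mu> x)" for x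
    unfolding S I[of x] sum_subtractf[symmetric] vec.scale_left_diff_distrib ..
  have "x = y \<longleftrightarrow> ?N *s y - ?N *s x = 0" for x y :: "(complex, 'g) vec"
    unfolding right_minus_eq vec.scale_cancel_left using N by blast
  then have "(\<forall>x. x = ?S x) \<longleftrightarrow> (\<forall>x. ?N *s ?S x - ?N *s x = 0)"
    by (rule all_cong1)
  also have "\<dots> \<longleftrightarrow> (\<forall>\<mu>. ?c \<mu> = 0)"
    unfolding diff
  proof
    assume "\<forall>x. (\<Sum>\<mu>\<in>UNIV. ?c \<mu> *s tf_shift \<mu> x) = 0"
    then show "\<forall>\<mu>. ?c \<mu> = 0"
      using tf_shift_independent[of ?c] by blast
  next
    assume "\<forall>\<mu>. ?c \<mu> = 0"
    then show "\<forall>x. (\<Sum>\<mu>\<in>UNIV. ?c \<mu> *s tf_shift \<mu> x) = 0"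
      by (simp only: vec.scale_zero_left sum.neutral_const simp_thms)
  qed
  also have "\<dots> \<longleftrightarrow> (\<forall>\<mu>\<in>?\<Lambda>0. ?L * ?a \<mu> = ?N * ?\<delta> \<mu>)"
  proof -
    \<comment> \<open>Outside the adjoint subgroup both coefficients vanish, since \<open>0\<close> lies inside.\<close>
    have "?c \<mu> = 0 \<longleftrightarrow> (\<mu> \<in> ?\<Lambda>0 \<longrightarrow> ?L * ?a \<mu> = ?N * ?\<delta> \<mu>)" for \<mu>
      using zero_in_adjoint_subgroup[of \<Lambda>] by (cases "\<mu> = 0") auto
    then show ?thesis by blast
  qed
  also have "\<dots> \<longleftrightarrow> (\<forall>\<mu>\<in>?\<Lambda>0. ?a \<mu> = ?N / ?L * ?\<delta> \<mu>)"
    using L by (intro ball_cong refl) (simp add: field_simps)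
  finally show ?thesis .
qed

end
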